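(* For every rectifiable embedded closed curve $\gamma\subset\mathbb R^3$, $$\operatorname{distort}(\gamma)\ge\frac12\,\frac{\operatorname{Len}(\gamma)}{\operatorname{diam}(\gamma)}.$$ Consequently, $$\operatorname{distort}(\gamma)\ge\frac14\,\frac{\operatorname{Len}(\gamma)}{R_{\min}(\gamma)}.$$
   Context: $\operatorname{Len}(\gamma)$ is the length of $\gamma$. The distortion is $\operatorname{distort}(\gamma)=\sup_{p,q\in\gamma,\,p\neq q}\frac{d_\gamma(p,q)}{|p-q|}$ (possibly $+\infty$), where $d_\gamma(p,q)$ is the shorter arclength distance between $p$ and $q$ along $\gamma$. Also $\operatorname{diam}(\gamma)=\sup_{x,y\in\gamma}|x-y|$ and $R_{\min}(\gamma)=\inf_{a\in\mathbb R^3}\sup_{x\in\gamma}|x-a|$ is the minimal enclosing radius. *)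

theory Defs
  imports "HOL-Analysis.Analysis"
begin

text \<open>A closed curve is given by a parametrization \<open>g\<close> on \<open>{0..1}\<close> with
  \<open>pathfinish g = pathstart g\<close>; it is embedded if \<open>simple_path g\<close>. Lengths and distortion take
  values in \<open>ennreal\<close>, so that they may be infinite.\<close>

text \<open>Length of \<open>g\<close> restricted to \<open>{a..b}\<close>, for \<open>a \<le> b\<close>: supremum of the lengths of inscribed
  polygons over all partitions \<open>a = t 0 \<le> \<dots> \<le> t n = b\<close>.\<close>

definition arc_length :: "(real \<Rightarrow> 'a::metric_space) \<Rightarrow> real \<Rightarrow> real \<Rightarrow> ennreal" where
  "arc_length g a b =
    (SUP (n, t) \<in> {(n::nat, t::nat \<Rightarrow> real). mono_on {..n} t \<and> t 0 = a \<and> t n = b}.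
      \<Sum>i<n. ennreal (dist (g (t i)) (g (t (Suc i)))))"

definition curve_length :: "(real \<Rightarrow> 'a::metric_space) \<Rightarrow> ennreal" where
  "curve_length g = arc_length g 0 1"

definition rectifiable :: "(real \<Rightarrow> 'a::metric_space) \<Rightarrow> bool" where
  "rectifiable g \<longleftrightarrow> curve_length g < \<infinity>"

text \<open>The points \<open>g s\<close> and \<open>g t\<close> with \<open>s \<le> t\<close> cut a closed curve into the arc over \<open>{s..t}\<close> and
  the complementary arc through the base point \<open>g 0 = g 1\<close>; the minimum is the length of the
  shorter one. For an embedded closed curve and \<open>p \<noteq> q\<close> on it, the pair \<open>(s, t)\<close> is unique, except
  that the parameters \<open>0\<close> and \<open>1\<close> both represent the base point, which gives the same two arcs;
  hence the infimum only ranges over equal values.\<close>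

definition curve_dist :: "(real \<Rightarrow> 'a::metric_space) \<Rightarrow> 'a \<Rightarrow> 'a \<Rightarrow> ennreal" where
  "curve_dist g p q =
    (INF (s, t) \<in> {(s, t). 0 \<le> s \<and> s \<le> t \<and> t \<le> 1 \<and> (g s = p \<and> g t = q \<or> g s = q \<and> g t = p)}.
      min (arc_length g s t) (arc_length g 0 s + arc_length g t 1))"

definition distortion :: "(real \<Rightarrow> 'a::metric_space) \<Rightarrow> ennreal" where
  "distortion g =
    (SUP (p, q) \<in> {(p, q). p \<in> path_image g \<and> q \<in> path_image g \<and> p \<noteq> q}.
      curve_dist g p q / ennreal (dist p q))"

definition min_enclosing_radius :: "'a::metric_space set \<Rightarrow> real" where
  "min_enclosing_radius S = (INF a. SUP x\<in>S. dist x a)"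

end

theory Submission
  imports Defs
begin

text \<open>Cut the curve at its base point \<open>g 0\<close> and at the point \<open>g s\<close> that halves its length. Their
  distance along the curve is half the length, while their distance in space is at most the
  diameter. Such an \<open>s\<close> exists because the lengths of the arcs over \<open>{0..s}\<close> and \<open>{s..1}\<close> are lower
  semicontinuous in \<open>s\<close> and add up to the whole length: the sets where the one or the other is at
  most half the length are closed and cover \<open>{0..1}\<close>, so they meet by connectedness. The second
  inequality follows because the diameter is at most twice the radius of any enclosing ball.\<close>

section \<open>Additivity and monotonicity of arc length\<close>

lemma arc_length_leI:
  assumes "\<And>n t. \<lbrakk>mono_on {..n} t; t 0 = a; t n = b\<rbrakk>
    \<Longrightarrow> (\<Sum>i<n. ennreal (dist (g (t i)) (g (t (Suc i))))) \<le> c"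
  shows "arc_length g a b \<le> c"
  unfolding arc_length_def using assms by (intro SUP_least) auto

lemma polygon_le_arc_length:
  assumes "mono_on {..n} t" "t 0 = a" "t n = b"
  shows "(\<Sum>i<n. ennreal (dist (g (t i)) (g (t (Suc i))))) \<le> arc_length g a b"
  unfolding arc_length_def using assms by (intro SUP_upper2[of "(n, t)"]) auto

lemma partition_bounds:
  fixes t :: "nat \<Rightarrow> real"
  assumes "mono_on {..n} t" "i \<le> n"
  shows "t 0 \<le> t i" "t i \<le> t n"
  using assms by (auto intro: mono_onD)

lemma arc_length_trivial [simp]: "arc_length g a a = 0"
proof -
  have "arc_length g a a \<le> 0"
  proof (rule arc_length_leI)
    fix n and t :: "nat \<Rightarrow> real"
    assume t: "mono_on {..n} t" "t 0 = a" "t n = a"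
    have "t i = a" if "i \<le> n" for i
      using partition_bounds[OF t(1) that] t(2,3) by simp
    then show "(\<Sum>i<n. ennreal (dist (g (t i)) (g (t (Suc i))))) \<le> 0"
      by simp
  qed
  then show ?thesis by simp
qed

text \<open>Clipping the partition points of \<open>{a..c}\<close> to \<open>{a..b}\<close> and to \<open>{b..c}\<close> splits the edge that
  passes \<open>b\<close>; of any other edge, one of the two copies is degenerate.\<close>

lemma arc_length_le_add:
  assumes "a \<le> b" "b \<le> c"
  shows "arc_length g a c \<le> arc_length g a b + arc_length g b c"
proof (rule arc_length_leI)
  fix n and t :: "nat \<Rightarrow> real"
  assume t: "mono_on {..n} t" "t 0 = a" "t n = c"
  let ?l = "\<lambda>i. min (t i) b" and ?r = "\<lambda>i. max (t i) b"
  have "dist (g (t i)) (g (t (Suc i))) \<le>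
      dist (g (?l i)) (g (?l (Suc i))) + dist (g (?r i)) (g (?r (Suc i)))" if "i < n" for i
  proof -
    have "t i \<le> t (Suc i)"
      using t(1) that by (auto intro: mono_onD)
    then show ?thesis
      by (cases "b \<le> t i"; cases "b \<le> t (Suc i)") (auto simp: min_def max_def dist_triangle)
  qed
  then have "(\<Sum>i<n. ennreal (dist (g (t i)) (g (t (Suc i))))) \<le>
      (\<Sum>i<n. ennreal (dist (g (?l i)) (g (?l (Suc i)))) + ennreal (dist (g (?r i)) (g (?r (Suc i)))))"
    by (intro sum_mono) (auto simp flip: ennreal_plus intro: ennreal_leI)
  also have "\<dots> = (\<Sum>i<n. ennreal (dist (g (?l i)) (g (?l (Suc i)))))
      + (\<Sum>i<n. ennreal (dist (g (?r i)) (g (?r (Suc i)))))"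
    by (rule sum.distrib)
  also have "\<dots> \<le> arc_length g a b + arc_length g b c"
    using t assms
    by (intro add_mono polygon_le_arc_length mono_onI min.mono max.mono order_refl mono_onD[OF t(1)])
       auto
  finally show "(\<Sum>i<n. ennreal (dist (g (t i)) (g (t (Suc i)))))
      \<le> arc_length g a b + arc_length g b c" .
qed

text \<open>A partition of \<open>{a..b}\<close> followed by one of \<open>{b..c}\<close> is a
  partition of \<open>{a..c}\<close> whose polygon length is the sum of the two. The suprema over
  the two partitions are then taken independently.\<close>

lemma arc_length_add_le:
  assumes "a \<le> b" "b \<le> c"
  shows "arc_length g a b + arc_length g b c \<le> arc_length g a c"
proof -
  let ?P = "\<lambda>(n, t). \<Sum>i<n. ennreal (dist (g (t i)) (g (t (Suc i))))"
  define I where "I a b = {(n::nat, t::nat \<Rightarrow> real). mono_on {..n} t \<and> t 0 = a \<and> t n = b}" for a b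
  have arc: "arc_length g a b = (SUP p\<in>I a b. ?P p)" for a b
    by (simp add: arc_length_def I_def)
  have concat: "?P p + ?P q \<le> arc_length g a c" if pq: "p \<in> I a b" "q \<in> I b c" for p q
  proof -
    obtain n t m u where [simp]: "p = (n, t)" "q = (m, u)" by (cases p, cases q)
    have t: "mono_on {..n} t" "t 0 = a" "t n = b" and u: "mono_on {..m} u" "u 0 = b" "u m = c"
      using pq by (auto simp: I_def)
    define v where "v i = (if i \<le> n then t i else u (i - n))" for i
    have vt: "v i = t i" if "i \<le> n" for i using that by (simp add: v_def)
    \<comment> \<open>At \<open>i = 0\<close> the definition of \<open>v\<close> selects
      \<open>t n\<close>; this agrees with \<open>u 0\<close> because both equal
      \<open>b\<close>.\<close>
    have vu: "v (n + i) = u i" for i using t u by (simp add: v_def)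
    have "mono_on {..n + m} v"
    proof (rule mono_onI)
      fix i j assume ij: "i \<in> {..n + m}" "j \<in> {..n + m}" "i \<le> j"
      consider "j \<le> n" | "i \<le> n" "n < j" | "n < i" by linarith
      then show "v i \<le> v j"
      proof cases
        case 1 then show ?thesis using ij t(1) by (auto simp: v_def intro: mono_onD)
      next
        case 2
        then have "t i \<le> b" "b \<le> u (j - n)"
          using partition_bounds[OF t(1), of i] partition_bounds[OF u(1), of "j - n"] t u ij by auto
        then show ?thesis using 2 by (simp add: v_def)
      next
        case 3 then show ?thesis using ij u(1) by (auto simp: v_def intro: mono_onD)
      qed
    qed
    moreover have "v 0 = a" "v (n + m) = c"
      using t u vt[of 0] vu[of m] by auto
    ultimately have "(\<Sum>i<n + m. ennreal (dist (g (v i)) (g (v (Suc i))))) \<le> arc_length g a c"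
      by (rule polygon_le_arc_length)
    also have "(\<Sum>i<n + m. ennreal (dist (g (v i)) (g (v (Suc i))))) =
        (\<Sum>i<n. ennreal (dist (g (v i)) (g (v (Suc i)))))
        + (\<Sum>i<m. ennreal (dist (g (v (n + i))) (g (v (n + Suc i)))))"
      by (induction m) (simp_all add: add.assoc)
    also have "\<dots> = ?P p + ?P q"
      by (simp add: vt vu del: add_Suc_right)
    finally show ?thesis .
  qed
  \<comment> \<open>Moving an \<open>ennreal\<close> summand into a supremum requires a nonempty
    index set; the one-edge partition provides an element.\<close>
  have "(1, \<lambda>i. if i = 0 then x else y) \<in> I x y" if "x \<le> y" for x y
    using that by (auto simp: I_def mono_on_def)
  then have ne: "I a b \<noteq> {}" "I b c \<noteq> {}"
    using assms by blast+
  have "arc_length g a b + arc_length g b c = (SUP p\<in>I a b. SUP q\<in>I b c. ?P p + ?P q)"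
    unfolding arc by (simp only: ennreal_SUP_add_left[OF ne(1), symmetric]
        ennreal_SUP_add_right[OF ne(2), symmetric])
  also have "\<dots> \<le> arc_length g a c"
    by (intro SUP_least concat)
  finally show ?thesis .
qed

lemma arc_length_mono:
  assumes "a \<le> a'" "a' \<le> b'" "b' \<le> b"
  shows "arc_length g a' b' \<le> arc_length g a b"
proof -
  have "arc_length g a' b' \<le> arc_length g a a' + arc_length g a' b'"
    by simp
  also have "\<dots> \<le> arc_length g a b'"
    using assms by (intro arc_length_add_le)
  also have "\<dots> \<le> arc_length g a b' + arc_length g b' b"
    by simp
  also have "\<dots> \<le> arc_length g a b"
    using assms by (intro arc_length_add_le) auto
  finally show ?thesis .
qed

section \<open>Lower semicontinuity of arc length\<close>

text \<open>Length is a supremum of polygon lengths, each continuous in its vertices, so its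
  sublevel sets are closed. Two variable endpoints \<open>u\<close> and \<open>v\<close> let one
  statement serve both the arcs over \<open>{a..s}\<close> and those over
  \<open>{s..c}\<close>.\<close>

lemma closed_arc_length_le:
  fixes u v :: "real \<Rightarrow> real"
  assumes g: "continuous_on {a..c} g" and u: "continuous_on {a..c} u" and v: "continuous_on {a..c} v"
    and bounds: "\<And>s. s \<in> {a..c} \<Longrightarrow> a \<le> u s \<and> u s \<le> v s \<and> v s \<le> c"
  shows "closed {s \<in> {a..c}. arc_length g (u s) (v s) \<le> k}"
  unfolding closed_sequential_limits
proof (intro allI impI, elim conjE)
  fix X x
  assume X: "\<forall>m. X m \<in> {s \<in> {a..c}. arc_length g (u s) (v s) \<le> k}" and lim: "X \<longlonglongrightarrow> x"
  have Xin: "X m \<in> {a..c}" for m using X by auto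
  have xin: "x \<in> {a..c}"
    using closed_sequentially[OF closed_atLeastAtMost Xin lim] .
  have ulim: "(\<lambda>m. u (X m)) \<longlonglongrightarrow> u x" and vlim: "(\<lambda>m. v (X m)) \<longlonglongrightarrow> v x"
    using Xin xin lim by (auto intro!: continuous_on_tendsto_compose[OF u] continuous_on_tendsto_compose[OF v])
  have "arc_length g (u x) (v x) \<le> k"
  proof (rule arc_length_leI)
    fix n and t :: "nat \<Rightarrow> real"
    assume t: "mono_on {..n} t" "t 0 = u x" "t n = v x"
    \<comment> \<open>The partition of \<open>{u x..v x}\<close> is clipped to the nearby interval
      \<open>{u (X m)..v (X m)}\<close>. In the limit the clipping has no effect, since every
      \<open>t i\<close> already lies between \<open>u x\<close> and \<open>v x\<close>.\<close>
    define w where "w m i = max (u (X m)) (min (t i) (v (X m)))" for m i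
    have win: "w m i \<in> {u (X m)..v (X m)}" for m i
      using bounds[OF Xin[of m]] by (auto simp: w_def)
    have glim: "(\<lambda>m. g (w m i)) \<longlonglongrightarrow> g (t i)" if "i \<le> n" for i
    proof (rule continuous_on_tendsto_compose[OF g])
      have ti: "u x \<le> t i" "t i \<le> v x"
        using partition_bounds[OF t(1) that] t by auto
      have "(\<lambda>m. w m i) \<longlonglongrightarrow> max (u x) (min (t i) (v x))"
        unfolding w_def by (intro tendsto_intros ulim vlim)
      then show "(\<lambda>m. w m i) \<longlonglongrightarrow> t i"
        using ti by (simp add: max_def min_def split: if_splits)
      show "t i \<in> {a..c}" using bounds[OF xin] ti by auto
      show "\<forall>\<^sub>F m in sequentially. w m i \<in> {a..c}"
      proof (rule always_eventually, rule allI)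
        fix m show "w m i \<in> {a..c}" using bounds[OF Xin[of m]] win[of m i] by auto
      qed
    qed
    have "(\<lambda>m. \<Sum>i<n. ennreal (dist (g (w m i)) (g (w m (Suc i)))))
        \<longlonglongrightarrow> (\<Sum>i<n. ennreal (dist (g (t i)) (g (t (Suc i)))))"
      by (intro tendsto_sum tendsto_ennrealI tendsto_dist glim) auto
    moreover have "(\<Sum>i<n. ennreal (dist (g (w m i)) (g (w m (Suc i))))) \<le> k" for m
    proof -
      have mono: "mono_on {..n} (w m)"
        unfolding w_def by (intro mono_onI max.mono min.mono order_refl mono_onD[OF t(1)])
      then have "(\<Sum>i<n. ennreal (dist (g (w m i)) (g (w m (Suc i))))) \<le> arc_length g (w m 0) (w m n)"
        by (rule polygon_le_arc_length) auto
      \<comment> \<open>The clipped points need not reach the endpoints of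
        \<open>{u (X m)..v (X m)}\<close>, so monotonicity in the interval is used here.\<close>
      also have "\<dots> \<le> arc_length g (u (X m)) (v (X m))"
        using win[of m 0] win[of m n] partition_bounds(1)[OF mono, of n]
        by (intro arc_length_mono) auto
      also have "\<dots> \<le> k" using X by auto
      finally show ?thesis .
    qed
    ultimately show "(\<Sum>i<n. ennreal (dist (g (t i)) (g (t (Suc i))))) \<le> k"
      by (intro Lim_bounded[where M = 0]) auto
  qed
  then show "x \<in> {s \<in> {a..c}. arc_length g (u s) (v s) \<le> k}" using xin by simp
qed

section \<open>Halving the length of an arc\<close>

lemma ennreal_half_add: "(x::ennreal) / 2 + x / 2 = x"
proof -
  have "x / 2 + x / 2 = x * 2 / 2"
    by (simp only: add_divide_distrib_ennreal mult_2_right)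
  also have "\<dots> = x"
    by (rule ennreal_mult_divide_eq) simp_all
  finally show ?thesis .
qed

lemma ennreal_inverse_antimono:
  assumes "(x::ennreal) \<le> y"
  shows "inverse y \<le> inverse x"
proof (cases "x = 0 \<or> y = top")
  case False
  then obtain r q where "x = ennreal r" "y = ennreal q" "0 < r" "0 < q"
    using assms by (cases x; cases y) (auto simp: top_unique)
  then show ?thesis
    using assms by (simp add: inverse_ennreal le_imp_inverse_le)
qed auto

lemma exists_arc_length_midpoint:
  assumes "a \<le> c" and g: "continuous_on {a..c} g" and fin: "arc_length g a c < \<infinity>"
  obtains s where "s \<in> {a..c}" "arc_length g a s = arc_length g a c / 2"
    "arc_length g s c = arc_length g a c / 2"
proof -
  define h where "h = arc_length g a c / 2"
  have hh: "h + h = arc_length g a c" by (simp add: h_def ennreal_half_add)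
  then have hfin: "h < \<infinity>" using fin by (auto simp flip: hh)
  let ?A = "{s \<in> {a..c}. arc_length g a s \<le> h}" and ?B = "{s \<in> {a..c}. arc_length g s c \<le> h}"
  have "closed ?A" "closed ?B"
    by (rule closed_arc_length_le[OF g]; simp)+
  \<comment> \<open>A point outside both sets would cut the arc into two pieces each longer than
    \<open>h\<close>, against superadditivity.\<close>
  moreover have "{a..c} \<subseteq> ?A \<union> ?B"
  proof
    fix s assume s: "s \<in> {a..c}"
    show "s \<in> ?A \<union> ?B"
    proof (rule ccontr)
      assume "s \<notin> ?A \<union> ?B"
      then have "h < arc_length g a s" "h < arc_length g s c" using s by auto
      then have "h + h < arc_length g a s + arc_length g s c" by (rule add_strict_mono)
      also have "\<dots> \<le> h + h" using arc_length_add_le[of a s c g] s hh by auto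
      finally show False by simp
    qed
  qed
  moreover have "a \<in> ?A" "c \<in> ?B" using \<open>a \<le> c\<close> by auto
  ultimately have "?A \<inter> ?B \<inter> {a..c} \<noteq> {}"
    using connected_closedD[OF connected_Icc, of ?A ?B a c] \<open>a \<le> c\<close>
    by (metis (no_types, lifting) IntI atLeastAtMost_iff empty_iff order_refl)
  then obtain s where s: "s \<in> {a..c}" "arc_length g a s \<le> h" "arc_length g s c \<le> h" by auto
  \<comment> \<open>Both pieces have length at most \<open>h\<close> while their sum is at least
    \<open>h + h\<close>; cancelling the finite \<open>h\<close> forces equality.\<close>
  have sum: "h + h \<le> arc_length g a s + arc_length g s c"
    using arc_length_le_add[of a s c g] s(1) hh by auto
  have "h \<le> arc_length g a s"
    using order_trans[OF sum add_left_mono[OF s(3)]] hfin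
    by (auto simp: ennreal_add_left_cancel_le add.commute)
  moreover have "h \<le> arc_length g s c"
    using order_trans[OF sum add_right_mono[OF s(2)]] hfin
    by (auto simp: ennreal_add_left_cancel_le)
  ultimately show ?thesis
    using s by (intro that[of s]) (auto simp: h_def)
qed

section \<open>Diameter and enclosing radius\<close>

lemma diameter_le_min_enclosing_radius:
  fixes S :: "'a::real_normed_vector set"
  assumes "bounded S" "S \<noteq> {}"
  shows "diameter S \<le> 2 * min_enclosing_radius S"
proof -
  have "diameter S / 2 \<le> (SUP x\<in>S. dist x a)" for a
  proof -
    \<comment> \<open>The supremum is real-valued, so it dominates the distances only once they are
      known to be bounded above. Two points of \<open>S\<close> are then compared through the centre
      \<open>a\<close>.\<close>
    have bdd: "bdd_above ((\<lambda>x. dist x a) ` S)"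
      using assms(1) by (metis bdd_above.I2 bounded_any_center dist_commute)
    have "dist x y \<le> 2 * (SUP x\<in>S. dist x a)" if "x \<in> S" "y \<in> S" for x y
      using cSUP_upper[OF that(1) bdd] cSUP_upper[OF that(2) bdd] dist_triangle2[of x y a] by linarith
    then have "diameter S \<le> 2 * (SUP x\<in>S. dist x a)"
      using assms(2) by (intro diameter_le) (auto simp: dist_norm)
    then show ?thesis by simp
  qed
  then have "diameter S / 2 \<le> min_enclosing_radius S"
    unfolding min_enclosing_radius_def by (intro cINF_greatest) auto
  then show ?thesis by simp
qed

section \<open>The distortion bounds\<close>

lemma half_length_div_diameter_le_distortion:
  assumes g: "simple_path g" "pathfinish g = pathstart g" and rect: "rectifiable g"
  shows "curve_length g / 2 / ennreal (diameter (path_image g)) \<le> distortion g"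
proof -
  define h where "h = curve_length g / 2"
  have cont: "continuous_on {0..1} g"
    using g(1) by (simp add: simple_path_def path_def)
  have closed: "g 1 = g 0"
    using g(2) by (simp add: pathfinish_def pathstart_def)
  obtain s where s: "s \<in> {0..1}" "arc_length g 0 s = h" "arc_length g s 1 = h"
    using exists_arc_length_midpoint[OF _ cont] rect
    by (auto simp: rectifiable_def curve_length_def h_def)
  show ?thesis
  proof (cases "h = 0")
    case True
    then show ?thesis by (simp add: h_def)
  next
    case False
    \<comment> \<open>If \<open>s\<close> were \<open>0\<close> or \<open>1\<close>, one of the two
      arcs of length \<open>h\<close> would be degenerate and \<open>h\<close> would vanish.\<close>
    then have s01: "0 < s" "s < 1"
      using s by (auto simp: less_le)
    have inj: "x = y \<or> x = 0 \<and> y = 1 \<or> x = 1 \<and> y = 0"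
      if "g x = g y" "x \<in> {0..1}" "y \<in> {0..1}" for x y
      using g(1) that unfolding simple_path_def loop_free_def by blast
    have ne: "g 0 \<noteq> g s"
      using inj[of 0 s] s01 by auto
    have pI: "g 0 \<in> path_image g" "g s \<in> path_image g"
      using s by (auto simp: path_image_def)
    have "h \<le> curve_dist g (g 0) (g s)"
      unfolding curve_dist_def
    proof (rule INF_greatest, clarify)
      fix x y :: real
      assume xy: "0 \<le> x" "x \<le> y" "y \<le> 1"
        and "g x = g 0 \<and> g y = g s \<or> g x = g s \<and> g y = g 0"
      \<comment> \<open>Injectivity up to identifying \<open>0\<close> with \<open>1\<close> leaves
        only these parameter pairs; in both, the arc and its complement have length
        \<open>h\<close>.\<close>
      then consider "x = 0" "y = s" | "x = s" "y = 1"
        using inj[of x 0] inj[of y s] inj[of x s] inj[of y 0] s01 by auto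
      then show "h \<le> min (arc_length g x y) (arc_length g 0 x + arc_length g y 1)"
        using s by cases auto
    qed
    moreover have "dist (g 0) (g s) \<le> diameter (path_image g)"
      using pI g(1) by (intro diameter_bounded_bound bounded_simple_path_image)
    \<comment> \<open>Passing from the left to the right, the numerator grows and the denominator
      shrinks.\<close>
    ultimately have "h / ennreal (diameter (path_image g))
        \<le> curve_dist g (g 0) (g s) / ennreal (dist (g 0) (g s))"
      unfolding divide_ennreal_def
      by (intro mult_mono ennreal_inverse_antimono ennreal_leI) auto
    also have "\<dots> \<le> distortion g"
      unfolding distortion_def using pI ne by (intro SUP_upper2[of "(g 0, g s)"]) auto
    finally show ?thesis by (simp add: h_def)
  qed
qed

theorem proposition8p1:
  fixes g :: "real \<Rightarrow> real ^ 3"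
  assumes "simple_path g"
    and "pathfinish g = pathstart g"
    and "rectifiable g"
  shows "distortion g \<ge> ennreal (1 / 2) * (curve_length g / ennreal (diameter (path_image g)))
    \<and> distortion g \<ge> ennreal (1 / 4) * (curve_length g / ennreal (min_enclosing_radius (path_image g)))"
proof -
  let ?L = "curve_length g" and ?D = "diameter (path_image g)"
    and ?R = "min_enclosing_radius (path_image g)"
  have diam: "inverse 2 * (?L / ennreal ?D) \<le> distortion g"
    using half_length_div_diameter_le_distortion[OF assms]
    by (simp add: divide_ennreal_def mult_ac)
  have "?D \<le> 2 * ?R"
    using assms(1) by (intro diameter_le_min_enclosing_radius bounded_simple_path_image) simp_all
  then have "inverse (ennreal (2 * ?R)) \<le> inverse (ennreal ?D)"
    by (intro ennreal_inverse_antimono ennreal_leI)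
  then have "inverse 2 * inverse (ennreal ?R) \<le> inverse (ennreal ?D)"
    by (simp add: ennreal_mult' ennreal_inverse_mult)
  \<comment> \<open>The constant \<open>1 / 4\<close> is the \<open>1 / 2\<close> of the diameter
    bound times the \<open>1 / 2\<close> coming from \<open>?D \<le> 2 * ?R\<close>.\<close>
  then have "inverse 2 * ?L * (inverse 2 * inverse (ennreal ?R)) \<le> inverse 2 * ?L * inverse (ennreal ?D)"
    by (rule mult_left_mono) simp
  then have "inverse 2 * inverse 2 * (?L / ennreal ?R) \<le> inverse 2 * (?L / ennreal ?D)"
    by (simp add: divide_ennreal_def mult_ac)
  moreover have "ennreal (1 / 4) = inverse 2 * inverse 2"
    by (simp flip: ennreal_half ennreal_mult)
  ultimately show ?thesis
    using diam by auto
qed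

end
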